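(* Let $p\ge2$ be a fixed integer, let $r$ be a constant, and let $G=(V,E)$ be a connected undirected $r$-regular graph with $n$ vertices and no double edges, where $n\equiv1\pmod p$. Then there are $\mathrm{R}^0(\mathrm{lin})$ refutations of $\neg\mathrm{TSEITIN}_{G,p}$ of size polynomial in $n$.
   Context: Linear equations $\vec a\cdot\vec x=a_0$ have integer coefficients, size $\sum|a_i|$ (unary); disjunctions: satisfied iff some equation holds; empty disjunction false; size = total size. Clause $\bigvee_{i\in I}x_i\vee\bigvee_{j\in J}\neg x_j$ translates to $\bigvee_{i\in I}(x_i=1)\vee\bigvee_{j\in J}(x_j=0)$. R(lin) proofs: each line initial, a Boolean axiom $(x_h=0)\vee(x_h=1)$, or derived by Resolution (from $A\vee L_1$, $B\vee L_2$ derive $A\vee B\vee(L_1\pm L_2)$), Weakening (from $A$ derive $A\vee L$), Simplification (from $A\vee(0=k)$, $k\ne0$, derive $A$); refutation = proof of empty disjunction. An $\mathrm{R}^0(\mathrm{lin})$-line: variable coefficients bounded by a fixed constant (free terms unbounded), partitionable into a constant number of sub-disjunctions each consisting of equations differing only in free terms or being a translated clause; $\mathrm{R}^0(\mathrm{lin})$ = R(lin) restricted to such lines. Let $G'=(V,E')$ be obtained from $G$ by replacing each edge by two opposite directed edges; for $v\in V$ let $e[v,1],\dots,e[v,r]$ be the edges of $E'$ leaving $v$. Variables $x_{e,i}$ for $e\in E'$, $i\in\{0,\dots,p-1\}$. $\neg\mathrm{TSEITIN}_{G,p}$ consists of: (1) $\bigvee_{i=0}^{p-1}(x_{e,i}=1)$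 for all $e\in E'$; (2) $(x_{e,i}=0)\vee(x_{e,j}=0)$ for all $i\ne j$ and $e\in E'$; (3) $(x_{e,i}=1)\vee(x_{\bar e,p-i}=0)$ and $(x_{e,i}=0)\vee(x_{\bar e,p-i}=1)$ for all opposite pairs $e,\bar e$ and all $i$ (where $x_{\bar e,p}$ means $x_{\bar e,0}$); (4) for all $v\in V$, all disjunctions $\bigvee_{k=1}^r(x_{e[v,k],i_k}=0)$ with $i_1,\dots,i_r\in\{0,\dots,p-1\}$ and $\sum_k i_k\not\equiv1\pmod p$. *)

theory Defs
  imports
    "HOL-Library.Poly_Mapping"
    "HOL-Library.Product_Plus"
    "HOL-Library.Disjoint_Sets"
    "HOL-Computational_Algebra.Polynomial"
    "HOL-Number_Theory.Cong"
    "Graph_Theory.Graph_Theory"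
begin

section \<open>Disjunctions of linear equations\<close>

text \<open>
  The pair \<open>(a, b)\<close> is the equation \<open>a \<cdot> x = b\<close>; equations are added and subtracted
  componentwise. A disjunction is a finite set of equations: order is irrelevant and identical
  equations are contracted, in particular in the conclusion of the resolution rule.
\<close>

type_synonym 'v lin_eq = "('v \<Rightarrow>\<^sub>0 int) \<times> int"
type_synonym 'v disj = "'v lin_eq set"

definition var_eq :: "'v \<Rightarrow> int \<Rightarrow> 'v lin_eq" where
  "var_eq x b = (Poly_Mapping.single x 1, b)"

definition eq_vars :: "'v lin_eq \<Rightarrow> 'v set" where
  "eq_vars L = Poly_Mapping.keys (fst L)"

text \<open>Coefficients are written in unary; the free term is counted as well.\<close>

definition eq_size :: "'v lin_eq \<Rightarrow> nat" where
  "eq_size L = (\<Sum>x\<in>Poly_Mapping.keys (fst L). nat \<bar>Poly_Mapping.lookup (fst L) x\<bar>) + nat \<bar>snd L\<bar>"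

definition disj_size :: "'v disj \<Rightarrow> nat" where
  "disj_size D = (\<Sum>L\<in>D. eq_size L)"

definition clause_disj :: "'v set \<Rightarrow> 'v set \<Rightarrow> 'v disj" where
  "clause_disj I J = (\<lambda>i. var_eq i 1) ` I \<union> (\<lambda>j. var_eq j 0) ` J"


section \<open>The proof systems R(lin) and R0(lin)\<close>

text \<open>
  \<open>rlin_step X K S D\<close>: the line \<open>D\<close> is allowed after the lines in \<open>S\<close>, in a proof over the
  variables \<open>X\<close> from the initial disjunctions \<open>K\<close>.
\<close>

inductive rlin_step :: "'v set \<Rightarrow> 'v disj set \<Rightarrow> 'v disj set \<Rightarrow> 'v disj \<Rightarrow> bool"
  for X K S where
  initial: "D \<in> K \<Longrightarrow> rlin_step X K S D"
| boolean: "x \<in> X \<Longrightarrow> rlin_step X K S {var_eq x 0, var_eq x 1}"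
| resolution_add: "insert L1 A \<in> S \<Longrightarrow> insert L2 B \<in> S \<Longrightarrow>
    rlin_step X K S (insert (L1 + L2) (A \<union> B))"
| resolution_diff: "insert L1 A \<in> S \<Longrightarrow> insert L2 B \<in> S \<Longrightarrow>
    rlin_step X K S (insert (L1 - L2) (A \<union> B))"
| weakening: "A \<in> S \<Longrightarrow> eq_vars L \<subseteq> X \<Longrightarrow> rlin_step X K S (insert L A)"
| simplification: "insert (0, k) A \<in> S \<Longrightarrow> k \<noteq> 0 \<Longrightarrow> rlin_step X K S A"

definition rlin_proof :: "'v set \<Rightarrow> 'v disj set \<Rightarrow> 'v disj list \<Rightarrow> 'v disj \<Rightarrow> bool" where
  "rlin_proof X K \<pi> D \<longleftrightarrow>
     \<pi> \<noteq> [] \<and> last \<pi> = D \<and> (\<forall>i<length \<pi>. rlin_step X K (set (take i \<pi>)) (\<pi> ! i))"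

definition rlin_refutation :: "'v set \<Rightarrow> 'v disj set \<Rightarrow> 'v disj list \<Rightarrow> bool" where
  "rlin_refutation X K \<pi> \<longleftrightarrow> rlin_proof X K \<pi> {}"

definition proof_size :: "'v disj list \<Rightarrow> nat" where
  "proof_size \<pi> = (\<Sum>D\<leftarrow>\<pi>. disj_size D)"

text \<open>
  The two constants in the notion of an R0(lin)-line are explicit: \<open>c\<close> bounds the absolute values
  of the variable coefficients, and \<open>k\<close> the number of sub-disjunctions in the partition.
\<close>

definition R0lin_line :: "nat \<Rightarrow> nat \<Rightarrow> 'v disj \<Rightarrow> bool" where
  "R0lin_line c k D \<longleftrightarrow>
     (\<forall>L\<in>D. \<forall>x. \<bar>Poly_Mapping.lookup (fst L) x\<bar> \<le> int c) \<and>
     (\<exists>P. partition_on D P \<and> finite P \<and> card P \<le> k \<and>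
        (\<forall>Q\<in>P. (\<forall>L\<in>Q. \<forall>L'\<in>Q. fst L = fst L') \<or>
               (\<exists>I J. finite I \<and> finite J \<and> Q = clause_disj I J)))"

definition R0lin_refutation ::
  "nat \<Rightarrow> nat \<Rightarrow> 'v set \<Rightarrow> 'v disj set \<Rightarrow> 'v disj list \<Rightarrow> bool" where
  "R0lin_refutation c k X K \<pi> \<longleftrightarrow> rlin_refutation X K \<pi> \<and> (\<forall>D\<in>set \<pi>. R0lin_line c k D)"

text \<open>
  Disjunctions are not finite by type, but from finite initial disjunctions only finite ones are
  derivable, so \<open>disj_size\<close> never is a sum over an infinite set.
\<close>

lemma rlin_step_finite:
  assumes "rlin_step X K S D" "\<forall>D\<in>K. finite D" "\<forall>D\<in>S. finite D"
  shows "finite D"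
proof -
  have fin: "finite A" if "insert L A \<in> S" for L A
    using assms(3) that by (metis finite_insert)
  show ?thesis
    using assms(1)
  proof cases
    case initial
    then show ?thesis using assms(2) by blast
  next
    case (boolean x)
    then show ?thesis by simp
  next
    case (resolution_add L1 A L2 B)
    then show ?thesis by (simp add: fin[of L1 A] fin[of L2 B])
  next
    case (resolution_diff L1 A L2 B)
    then show ?thesis by (simp add: fin[of L1 A] fin[of L2 B])
  next
    case (weakening A L)
    then show ?thesis using assms(3) by simp
  next
    case (simplification k)
    then show ?thesis using fin by blast
  qed
qed

lemma rlin_proof_finite:
  assumes "rlin_proof X K \<pi> D" "\<forall>D\<in>K. finite D" "E \<in> set \<pi>"
  shows "finite E"
proof -
  have "finite (\<pi> ! i)" if "i < length \<pi>" for i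
    using that
  proof (induction i rule: less_induct)
    case (less i)
    have "finite A" if "A \<in> set (take i \<pi>)" for A
      using that less by (auto simp: in_set_conv_nth)
    then show ?case
      using rlin_step_finite[of X K "set (take i \<pi>)" "\<pi> ! i"] less.prems assms
      by (auto simp: rlin_proof_def)
  qed
  then show ?thesis
    using assms(3) by (auto simp: in_set_conv_nth)
qed


section \<open>The Tseitin formulas modulo p\<close>

text \<open>
  An undirected graph without loops and double edges is rendered by the locale \<open>graph\<close>, which
  represents it as a symmetric digraph: every undirected edge is present as two opposite arcs. So
  \<open>arcs G\<close> is the edge set of the directed graph obtained by replacing each edge by two opposite
  directed edges, \<open>out_arcs G v\<close> are the directed edges leaving \<open>v\<close>, and \<open>out_degree G v\<close> is
  the degree of \<open>v\<close> in the undirected graph.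
\<close>

definition regular :: "('a, 'b) pre_digraph \<Rightarrow> nat \<Rightarrow> bool" where
  "regular G r \<longleftrightarrow> (\<forall>v\<in>verts G. out_degree G v = r)"

definition opposite :: "('a, 'b) pre_digraph \<Rightarrow> 'b \<Rightarrow> 'b \<Rightarrow> bool" where
  "opposite G e e' \<longleftrightarrow>
     e \<in> arcs G \<and> e' \<in> arcs G \<and> tail G e' = head G e \<and> head G e' = tail G e"

text \<open>The variable \<open>x\<^bsub>e,i\<^esub>\<close> is the pair \<open>(e, i)\<close>.\<close>

definition tseitin_vars :: "('a, 'b) pre_digraph \<Rightarrow> nat \<Rightarrow> ('b \<times> nat) set" where
  "tseitin_vars G p = arcs G \<times> {..<p}"

text \<open>
  In the third part \<open>(p - i) mod p\<close> realises the convention that \<open>x\<^bsub>e,p\<^esub>\<close> means \<open>x\<^bsub>e,0\<^esub>\<close>. In the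
  fourth part the tuple of values is indexed by the arcs leaving \<open>v\<close> instead of by an
  enumeration of them.
\<close>

definition neg_tseitin :: "('a, 'b) pre_digraph \<Rightarrow> nat \<Rightarrow> ('b \<times> nat) disj set" where
  "neg_tseitin G p =
     {{var_eq (e, i) 1 |i. i < p} |e. e \<in> arcs G} \<union>
     {{var_eq (e, i) 0, var_eq (e, j) 0} |e i j. e \<in> arcs G \<and> i < p \<and> j < p \<and> i \<noteq> j} \<union>
     ({{var_eq (e, i) 1, var_eq (e', (p - i) mod p) 0} |e e' i. opposite G e e' \<and> i < p} \<union>
      {{var_eq (e, i) 0, var_eq (e', (p - i) mod p) 1} |e e' i. opposite G e e' \<and> i < p}) \<union>
     {{var_eq (e, f e) 0 |e. e \<in> out_arcs G v} |v f.
        v \<in> verts G \<and> (\<forall>e\<in>out_arcs G v. f e < p) \<and> \<not> [(\<Sum>e\<in>out_arcs G v. f e) = 1] (mod p)}"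

lemma neg_tseitin_finite:
  assumes "fin_digraph G" "D \<in> neg_tseitin G p"
  shows "finite D"
  using assms
  by (auto simp: neg_tseitin_def setcompr_eq_image fin_digraph.finite_arcs)

end

theory Submission
  imports Defs
begin

text \<open>
  Encode the value on an arc \<open>e\<close> by the linear form \<open>\<Sum>i. i * x\<^bsub>e,i\<^esub>\<close>. For each vertex the clauses
  yield, by a case analysis over constantly many variables, that the sum of these forms over the
  outgoing arcs is congruent to 1; for each pair of opposite arcs they yield that the sum is
  congruent to 0. Each fact is a disjunction of equations with a common left-hand side. Adding up the
  vertex facts and subtracting the edge facts, all variables cancel and what remains is a
  disjunction of equations \<open>0 = b\<close> with \<open>b\<close> congruent to \<open>n\<close>, that is to 1, modulo \<open>p\<close>. The sums range over
  polynomially many values, and intermediate lines involve at most three different left-hand sides.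
\<close>

section \<open>Derivations inside a set of lines\<close>

lemma rlin_step_mono:
  assumes "rlin_step X K S D" "S \<subseteq> S'"
  shows "rlin_step X K S' D"
  using assms(1)
proof cases
  case (resolution_add L1 A L2 B)
  then show ?thesis using assms(2) by (auto intro: rlin_step.resolution_add)
next
  case (resolution_diff L1 A L2 B)
  then show ?thesis using assms(2) by (auto intro: rlin_step.resolution_diff)
next
  case (weakening A L)
  then show ?thesis using assms(2) by (auto intro: rlin_step.weakening)
next
  case (simplification k)
  then show ?thesis using assms(2) by (auto intro: rlin_step.simplification)
qed (auto intro: rlin_step.intros)

text \<open>Provability without the order of a list: premises only have to be derivable themselves,
  and every line used lies in \<open>\<Lambda>\<close>. Derivations may share lines freely, and the
  size of \<open>\<Lambda>\<close> later bounds the size of the proof.\<close>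

inductive derivable :: "'v set \<Rightarrow> 'v disj set \<Rightarrow> 'v disj set \<Rightarrow> 'v disj \<Rightarrow> bool"
  for X K \<Lambda> where
  step: "rlin_step X K S D \<Longrightarrow> (\<And>E. E \<in> S \<Longrightarrow> derivable X K \<Lambda> E) \<Longrightarrow> D \<in> \<Lambda> \<Longrightarrow> derivable X K \<Lambda> D"

lemma derivable_mono:
  "derivable X K \<Lambda> D \<Longrightarrow> \<Lambda> \<subseteq> \<Lambda>' \<Longrightarrow> derivable X K \<Lambda>' D"
  by (induction rule: derivable.induct) (blast intro: derivable.step)

lemma derivable_initial: "D \<in> K \<Longrightarrow> D \<in> \<Lambda> \<Longrightarrow> derivable X K \<Lambda> D"
  by (rule derivable.step[where S = "{}"]) (auto intro: rlin_step.initial)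

lemma derivable_boolean:
  "x \<in> X \<Longrightarrow> {var_eq x 0, var_eq x 1} \<in> \<Lambda> \<Longrightarrow> derivable X K \<Lambda> {var_eq x 0, var_eq x 1}"
  by (rule derivable.step[where S = "{}"]) (auto intro: rlin_step.boolean)

lemma derivable_resolution_add:
  assumes "derivable X K \<Lambda> (insert L1 A)" "derivable X K \<Lambda> (insert L2 B)"
    "insert (L1 + L2) (A \<union> B) \<in> \<Lambda>"
  shows "derivable X K \<Lambda> (insert (L1 + L2) (A \<union> B))"
  by (rule derivable.step[where S = "{insert L1 A, insert L2 B}"])
    (use assms in \<open>auto intro: rlin_step.resolution_add\<close>)

lemma derivable_resolution_diff:
  assumes "derivable X K \<Lambda> (insert L1 A)" "derivable X K \<Lambda> (insert L2 B)"
    "insert (L1 - L2) (A \<union> B) \<in> \<Lambda>"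
  shows "derivable X K \<Lambda> (insert (L1 - L2) (A \<union> B))"
  by (rule derivable.step[where S = "{insert L1 A, insert L2 B}"])
    (use assms in \<open>auto intro: rlin_step.resolution_diff\<close>)

lemma derivable_weakening:
  assumes "derivable X K \<Lambda> A" "eq_vars L \<subseteq> X" "insert L A \<in> \<Lambda>"
  shows "derivable X K \<Lambda> (insert L A)"
  by (rule derivable.step[where S = "{A}"]) (use assms in \<open>auto intro: rlin_step.weakening\<close>)

lemma derivable_simplification:
  assumes "derivable X K \<Lambda> (insert (0, k) A)" "k \<noteq> 0" "A \<in> \<Lambda>"
  shows "derivable X K \<Lambda> A"
  by (rule derivable.step[where S = "{insert (0, k) A}"])
    (use assms in \<open>auto intro: rlin_step.simplification\<close>)

lemma derivable_weakening_set:
  assumes "derivable X K \<Lambda> A" "finite B" "\<And>L. L \<in> B \<Longrightarrow> eq_vars L \<subseteq> X"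
    "\<And>B'. B' \<subseteq> B \<Longrightarrow> A \<union> B' \<in> \<Lambda>"
  shows "derivable X K \<Lambda> (A \<union> B)"
  using assms(2-4)
proof (induction B)
  case (insert L B)
  then have "derivable X K \<Lambda> (A \<union> B)" by blast
  then have "derivable X K \<Lambda> (insert L (A \<union> B))"
    using insert.prems(2)[of "insert L B"] by (intro derivable_weakening) (auto simp: insert.prems)
  then show ?case by simp
qed (use assms(1) in simp)

text \<open>
  Repetition-free proofs with lines in the finite set \<open>\<Lambda>\<close> have bounded length, and a longest one
  contains every derivable line. So proof size is controlled by counting available lines.
\<close>

lemma derivable_imp_rlin_proof:
  assumes "derivable X K \<Lambda> D" "finite \<Lambda>"
  shows "\<exists>\<pi>. rlin_proof X K \<pi> D \<and> distinct \<pi> \<and> set \<pi> \<subseteq> \<Lambda>"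
proof -
  define valid where "valid \<pi> \<longleftrightarrow> (\<forall>i<length \<pi>. rlin_step X K (set (take i \<pi>)) (\<pi> ! i)) \<and>
    distinct \<pi> \<and> set \<pi> \<subseteq> \<Lambda>" for \<pi>
  have "valid []" by (simp add: valid_def)
  moreover have "length \<pi> \<le> card \<Lambda>" if "valid \<pi>" for \<pi>
    using that card_mono[OF assms(2), of "set \<pi>"] by (simp add: valid_def distinct_card)
  ultimately obtain \<pi> where \<pi>: "valid \<pi>" and max: "\<And>\<rho>. valid \<rho> \<Longrightarrow> length \<rho> \<le> length \<pi>"
    using ex_has_greatest_nat[of valid "[]" length "Suc (card \<Lambda>)"] by (force simp: less_Suc_eq_le)
  have "D \<in> set \<pi>"
    using assms(1)
  proof (induction rule: derivable.induct)
    case (step S D)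
    show ?case
    proof (rule ccontr)
      assume "D \<notin> set \<pi>"
      moreover have "rlin_step X K (set \<pi>) D"
        using step by (intro rlin_step_mono[OF step.hyps(1)]) blast
      ultimately have "valid (\<pi> @ [D])"
        using \<pi> step.hyps by (auto simp: valid_def nth_append less_Suc_eq)
      then show False using max by fastforce
    qed
  qed
  then obtain i where i: "i < length \<pi>" "\<pi> ! i = D"
    by (auto simp: in_set_conv_nth)
  \<comment> \<open>A prefix of a valid sequence is valid, so cutting right after \<open>D\<close>
    gives a proof that ends in \<open>D\<close>.\<close>
  let ?\<rho> = "take (Suc i) \<pi>"
  have "rlin_proof X K ?\<rho> D"
    using i \<pi> by (auto simp: rlin_proof_def valid_def min_def take_Suc_conv_app_nth nth_append
        less_Suc_eq)
  moreover have "distinct ?\<rho>" "set ?\<rho> \<subseteq> \<Lambda>"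
    using \<pi> by (auto simp: valid_def dest: in_set_takeD)
  ultimately show ?thesis by blast
qed

text \<open>Grouping the equations by left-hand side gives a partition with one block per left-hand
  side, so it suffices to count left-hand sides.\<close>

lemma R0lin_lineI:
  assumes "finite (fst ` D)" "card (fst ` D) \<le> k"
    "\<And>L x. L \<in> D \<Longrightarrow> \<bar>Poly_Mapping.lookup (fst L) x\<bar> \<le> int c"
  shows "R0lin_line c k D"
proof -
  let ?P = "(\<lambda>F. {L \<in> D. fst L = F}) ` fst ` D"
  have "partition_on D ?P"
    by (auto simp: partition_on_def disjoint_def)
  moreover have "card ?P \<le> k"
    using assms(1,2) card_image_le le_trans by blast
  ultimately show ?thesis
    using assms(1,3) unfolding R0lin_line_def by (intro conjI exI[of _ ?P]) auto
qed

section \<open>Size accounting for sets of available lines\<close>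

definition good_line :: "nat \<Rightarrow> nat \<Rightarrow> nat \<Rightarrow> 'v disj \<Rightarrow> bool" where
  "good_line c k s D \<longleftrightarrow> R0lin_line c k D \<and> disj_size D \<le> s"

text \<open>Here \<open>m\<close> counts available lines rather than the length of a particular
  proof, so these counts add up under unions and no list has to be built before the end.\<close>

definition provable ::
  "nat \<Rightarrow> nat \<Rightarrow> nat \<Rightarrow> 'v set \<Rightarrow> 'v disj set \<Rightarrow> nat \<Rightarrow> 'v disj \<Rightarrow> bool" where
  "provable c k s X K m D \<longleftrightarrow>
     (\<exists>\<Lambda>. finite \<Lambda> \<and> card \<Lambda> \<le> m \<and> (\<forall>E\<in>\<Lambda>. good_line c k s E) \<and> derivable X K \<Lambda> D)"

lemma provable_refutation:
  assumes "provable c k s X K m {}"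
  shows "\<exists>\<pi>. R0lin_refutation c k X K \<pi> \<and> proof_size \<pi> \<le> m * s"
proof -
  obtain \<Lambda> where \<Lambda>: "finite \<Lambda>" "card \<Lambda> \<le> m" "\<forall>E\<in>\<Lambda>. good_line c k s E" "derivable X K \<Lambda> {}"
    using assms by (auto simp: provable_def)
  obtain \<pi> where \<pi>: "rlin_proof X K \<pi> {}" "distinct \<pi>" "set \<pi> \<subseteq> \<Lambda>"
    using derivable_imp_rlin_proof[OF \<Lambda>(4,1)] by blast
  have "proof_size \<pi> = (\<Sum>D\<in>set \<pi>. disj_size D)"
    using \<pi>(2) by (simp add: proof_size_def sum_list_distinct_conv_sum_set)
  also have "\<dots> \<le> card (set \<pi>) * s"
    using sum_bounded_above[of "set \<pi>" disj_size s] \<pi>(3) \<Lambda>(3) by (auto simp: good_line_def)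
  also have "\<dots> \<le> m * s"
    using card_mono[OF \<Lambda>(1) \<pi>(3)] \<Lambda>(2) by (intro mult_right_mono) auto
  finally have "proof_size \<pi> \<le> m * s" .
  moreover have "R0lin_refutation c k X K \<pi>"
    using \<pi> \<Lambda>(3) by (auto simp: R0lin_refutation_def rlin_refutation_def good_line_def)
  ultimately show ?thesis by blast
qed

text \<open>The three sets of lines are united. The last hypothesis ranges over all supersets of
  \<open>\<Lambda>\<close> because the final derivation takes place inside that union.\<close>

lemma provable_combine:
  assumes "provable c k s X K m1 D1" "provable c k s X K m2 D2"
    "finite \<Lambda>" "card \<Lambda> \<le> m" "\<And>E. E \<in> \<Lambda> \<Longrightarrow> good_line c k s E"
    "\<And>\<Lambda>'. \<Lambda> \<subseteq> \<Lambda>' \<Longrightarrow> derivable X K \<Lambda>' D1 \<Longrightarrow> derivable X K \<Lambda>' D2 \<Longrightarrow> derivable X K \<Lambda>' D"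
  shows "provable c k s X K (m1 + m2 + m) D"
proof -
  obtain \<Lambda>1 where 1: "finite \<Lambda>1" "card \<Lambda>1 \<le> m1" "\<forall>E\<in>\<Lambda>1. good_line c k s E" "derivable X K \<Lambda>1 D1"
    using assms(1) by (auto simp: provable_def)
  obtain \<Lambda>2 where 2: "finite \<Lambda>2" "card \<Lambda>2 \<le> m2" "\<forall>E\<in>\<Lambda>2. good_line c k s E" "derivable X K \<Lambda>2 D2"
    using assms(2) by (auto simp: provable_def)
  let ?\<Lambda> = "\<Lambda>1 \<union> \<Lambda>2 \<union> \<Lambda>"
  have "derivable X K ?\<Lambda> D"
    by (intro assms(6) derivable_mono[OF 1(4)] derivable_mono[OF 2(4)]) auto
  moreover have "card ?\<Lambda> \<le> m1 + m2 + m"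
    using card_Un_le[of "\<Lambda>1 \<union> \<Lambda>2" \<Lambda>] card_Un_le[of \<Lambda>1 \<Lambda>2] 1(2) 2(2) assms(4) by linarith
  ultimately show ?thesis
    using 1 2 assms(3,5) unfolding provable_def
    by (intro exI[of _ ?\<Lambda>]) auto
qed

lemma disj_size_le:
  assumes "finite D" "card D \<le> N" "\<And>L. L \<in> D \<Longrightarrow> eq_size L \<le> t"
  shows "disj_size D \<le> N * t"
proof -
  have "disj_size D \<le> card D * t"
    unfolding disj_size_def using sum_bounded_above[of D eq_size t] assms(3) by auto
  also have "\<dots> \<le> N * t" using assms(2) by simp
  finally show ?thesis .
qed


section \<open>Lines about boundedly many arcs\<close>

text \<open>The sum over \<open>T\<close> of the forms encoding the values on single arcs. Distinct
  arcs have distinct variables, so coefficients stay below \<open>p\<close> however large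
  \<open>T\<close> is; this keeps long sums inside R0(lin).\<close>

definition flow :: "nat \<Rightarrow> 'b set \<Rightarrow> ('b \<times> nat) \<Rightarrow>\<^sub>0 int" where
  "flow p T = (\<Sum>e\<in>T. \<Sum>i<p. Poly_Mapping.single (e, i) (int i))"

lemma lookup_inner_flow:
  "Poly_Mapping.lookup (\<Sum>i<m. Poly_Mapping.single (e, i) (int i)) (e', j) =
     (if e' = e \<and> j < m then int j else 0)"
  by (induction m) (auto simp: lookup_add lookup_single when_def)

lemma lookup_flow:
  "finite T \<Longrightarrow> Poly_Mapping.lookup (flow p T) (e, i) = (if e \<in> T \<and> i < p then int i else 0)"
  unfolding flow_def
  by (induction T rule: finite_induct) (auto simp: lookup_add lookup_inner_flow)

lemma flow_empty [simp]: "flow p {} = 0"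
  by (simp add: flow_def)

lemma flow_union_disjoint:
  "finite A \<Longrightarrow> finite B \<Longrightarrow> A \<inter> B = {} \<Longrightarrow> flow p (A \<union> B) = flow p A + flow p B"
  by (simp add: flow_def sum.union_disjoint)

lemma flow_diff:
  assumes "finite A" "B \<subseteq> A"
  shows "flow p (A - B) = flow p A - flow p B"
  using flow_union_disjoint[of "A - B" B p] assms finite_subset[OF assms(2,1)]
  by (simp add: Un_absorb2 Int_commute)

lemma keys_flow: "finite T \<Longrightarrow> Poly_Mapping.keys (flow p T) \<subseteq> T \<times> {..<p}"
  by (auto simp: in_keys_iff lookup_flow split: if_splits)

text \<open>A finite universe of equations about the arcs in \<open>T\<close>. For constant
  \<open>p\<close>, \<open>C\<close> and \<open>card T\<close> it has constant size, so a local
  derivation may use every subset of it as a line without harming the size bound.\<close>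

definition box_eqs :: "nat \<Rightarrow> nat \<Rightarrow> 'b set \<Rightarrow> ('b \<times> nat) lin_eq set" where
  "box_eqs p C T = {(F, b). Poly_Mapping.keys F \<subseteq> T \<times> {..<p} \<and>
     (\<forall>x. 0 \<le> Poly_Mapping.lookup F x \<and> Poly_Mapping.lookup F x \<le> int p) \<and> \<bar>b\<bar> \<le> int C}"

lemma var_eq_in_box_eqs:
  "e \<in> T \<Longrightarrow> i < p \<Longrightarrow> \<bar>b\<bar> \<le> int C \<Longrightarrow> var_eq (e, i) b \<in> box_eqs p C T"
  by (auto simp: box_eqs_def var_eq_def lookup_single when_def)

lemma flow_in_box_eqs:
  assumes "finite A" "A \<subseteq> T" "\<bar>b\<bar> \<le> int C"
  shows "(flow p A, b) \<in> box_eqs p C T"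
  using assms keys_flow[OF assms(1), of p] by (auto simp: box_eqs_def lookup_flow)

lemma eq_vars_box_eqs: "L \<in> box_eqs p C T \<Longrightarrow> eq_vars L \<subseteq> T \<times> {..<p}"
  by (auto simp: box_eqs_def eq_vars_def)

text \<open>If \<open>(e, i)\<close> is not 0 it is 1, and then the at-most-one clauses make all
  other variables of \<open>e\<close> zero. Adding these equations, the one for
  \<open>(e, j)\<close> taken \<open>j\<close> times, gives value \<open>i\<close> on
  \<open>e\<close>; the escape \<open>(e, i) = 0\<close> is carried along.\<close>

lemma derivable_arc_value:
  assumes X: "T \<times> {..<p} \<subseteq> X" and C: "p \<le> C" and e: "e \<in> T" and i: "i < p"
    and amo: "\<And>j. j < p \<Longrightarrow> j \<noteq> i \<Longrightarrow>
      derivable X K (Pow (box_eqs p C T)) {var_eq (e, i) 0, var_eq (e, j) 0}"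
  shows "derivable X K (Pow (box_eqs p C T)) {var_eq (e, i) 0, (flow p {e}, int i)}"
proof -
  let ?D = "derivable X K (Pow (box_eqs p C T))"
  let ?Z = "\<lambda>m. \<Sum>j<m. Poly_Mapping.single (e, j) (int j)"
  have ei: "var_eq (e, i) b \<in> box_eqs p C T" if "\<bar>b\<bar> \<le> 1" for b
    using that e i C by (intro var_eq_in_box_eqs) auto
  have base: "?D {var_eq (e, i) 0, var_eq (e, i) 1}"
    using e i X ei by (intro derivable_boolean) auto
  have val: "?D {var_eq (e, i) 0, var_eq (e, j) (if j = i then 1 else 0)}" if "j < p" for j
    using base amo[OF that] by auto
  \<comment> \<open>Starting point of the summation: the equation \<open>(e, i) = 1\<close>
    subtracted from itself leaves 0 = 0.\<close>
  have zero: "?D {var_eq (e, i) 0, (0, 0)}"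
  proof -
    have diff: "var_eq (e, i) 1 - var_eq (e, i) 1 = (0, 0)"
      by (simp add: zero_prod_def)
    have base': "?D (insert (var_eq (e, i) 1) {var_eq (e, i) 0})"
      using base by (simp add: insert_commute)
    have "(0, 0) \<in> box_eqs p C T" by (simp add: box_eqs_def)
    then have "?D (insert (var_eq (e, i) 1 - var_eq (e, i) 1) ({var_eq (e, i) 0} \<union> {var_eq (e, i) 0}))"
      using ei[of 0] by (intro derivable_resolution_diff[OF base' base']) (simp add: zero_prod_def)
    then show ?thesis unfolding diff by (simp add: insert_commute)
  qed
  \<comment> \<open>Resolution adds an equation only once, so multiplying by \<open>j\<close> takes
    \<open>j\<close> steps, counted by \<open>t\<close>. The coefficient of \<open>(e, j)\<close>
    starts at 0 and ends at \<open>j\<close>, hence stays in the box.\<close>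
  have add: "?D {var_eq (e, i) 0, (F + Poly_Mapping.single (e, j) (int t), b + (if j = i then int t else 0))}"
    if F: "?D {var_eq (e, i) 0, (F, b)}" and j: "j < p" and t: "t \<le> j"
      and box: "(F, b) \<in> box_eqs p C T" "Poly_Mapping.lookup F (e, j) = 0"
      and b: "\<bar>b + (if j = i then int j else 0)\<bar> \<le> int C" "0 \<le> b" for F b j t
    using t
  proof (induction t)
    case 0
    then show ?case using F by simp
  next
    case (Suc t)
    let ?L = "(F + Poly_Mapping.single (e, j) (int t), b + (if j = i then int t else 0))"
    let ?L2 = "var_eq (e, j) (if j = i then 1 else 0)"
    have eq: "?L + ?L2 =
        (F + Poly_Mapping.single (e, j) (int (Suc t)), b + (if j = i then int (Suc t) else 0))"
      by (auto simp: var_eq_def add.assoc single_add[symmetric] add.commute)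
    have "?L + ?L2 \<in> box_eqs p C T"
      unfolding eq using Suc.prems j box b e
      by (auto simp: box_eqs_def lookup_add lookup_single when_def dest!: subsetD[OF Poly_Mapping.keys_add]
          split: if_splits)
    moreover have "?D (insert ?L {var_eq (e, i) 0})" "?D (insert ?L2 {var_eq (e, i) 0})"
      using Suc val[OF j] by (simp_all add: insert_commute)
    ultimately have "?D (insert (?L + ?L2) ({var_eq (e, i) 0} \<union> {var_eq (e, i) 0}))"
      using ei[of 0] by (intro derivable_resolution_add) auto
    then show ?case unfolding eq by (simp add: insert_commute)
  qed
  have "?D {var_eq (e, i) 0, (?Z m, if i < m then int i else 0)}" if "m \<le> p" for m
    using that
  proof (induction m)
    case 0
    then show ?case using zero by simp
  next
    case (Suc m)
    have keys: "Poly_Mapping.keys (?Z m) \<subseteq> T \<times> {..<p}"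
      using e Suc.prems by (auto simp: in_keys_iff lookup_inner_flow split: if_splits)
    have "(?Z m, if i < m then int i else 0) \<in> box_eqs p C T"
      using keys i C Suc.prems by (auto simp: box_eqs_def lookup_inner_flow)
    then show ?case
      using add[of "?Z m" "if i < m then int i else 0" m m] Suc i C
      by (auto simp: lookup_inner_flow less_Suc_eq split: if_splits)
  qed
  from this[of p] show ?thesis using i by (simp add: flow_def)
qed

text \<open>The lines of \<open>derivable_arc_value\<close> for the arcs in \<open>A\<close> are
  added one after the other: forms and values add up, and the escape literals accumulate to the
  clause excluding \<open>f\<close>.\<close>

lemma derivable_clause_or_flow:
  assumes X: "T \<times> {..<p} \<subseteq> X" and C: "card T * p \<le> C" "p \<le> C" and T: "finite T"
    and amo: "\<And>e i j. e \<in> T \<Longrightarrow> i < p \<Longrightarrow> j < p \<Longrightarrow> j \<noteq> i \<Longrightarrow>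
      derivable X K (Pow (box_eqs p C T)) {var_eq (e, i) 0, var_eq (e, j) 0}"
    and f: "\<And>e. e \<in> T \<Longrightarrow> f e < p" and A: "A \<subseteq> T" "A \<noteq> {}"
  shows "derivable X K (Pow (box_eqs p C T))
    (insert (flow p A, int (\<Sum>e\<in>A. f e)) ((\<lambda>e. var_eq (e, f e) 0) ` A))"
  using finite_subset[OF A(1) T] A(2,1)
proof (induction A rule: finite_ne_induct)
  case (singleton e)
  then show ?case
    using derivable_arc_value[OF X C(2), of e "f e" K] amo f by (simp add: insert_commute)
next
  case (insert e A)
  let ?c = "\<lambda>A. (\<lambda>e. var_eq (e, f e) 0) ` A"
  let ?L1 = "(flow p A, int (\<Sum>e\<in>A. f e))" and ?L2 = "(flow p {e}, int (f e))"
  have fin: "finite (insert e A)" using insert by simp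
  have "(\<Sum>e\<in>insert e A. f e) \<le> card (insert e A) * p"
    using sum_bounded_above[of "insert e A" f p] f insert.prems by (force simp: less_imp_le)
  also have "\<dots> \<le> C"
    using card_mono[OF T insert.prems] C(1) by (meson le_trans mult_le_mono1)
  finally have le: "(\<Sum>e\<in>insert e A. f e) \<le> C" .
  have eq: "?L1 + ?L2 = (flow p (insert e A), int (\<Sum>e\<in>insert e A. f e))"
    using flow_union_disjoint[of A "{e}" p] insert by (simp add: add.commute)
  have "?c A \<subseteq> box_eqs p C T"
    using insert.prems f by (intro image_subsetI var_eq_in_box_eqs) auto
  moreover have "var_eq (e, f e) 0 \<in> box_eqs p C T"
    using insert.prems f by (intro var_eq_in_box_eqs) auto
  moreover have "?L1 + ?L2 \<in> box_eqs p C T"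
    unfolding eq using insert.prems le fin by (intro flow_in_box_eqs) linarith+
  ultimately have "insert (?L1 + ?L2) (?c A \<union> {var_eq (e, f e) 0}) \<subseteq> box_eqs p C T"
    by simp
  moreover have "derivable X K (Pow (box_eqs p C T)) (insert ?L2 {var_eq (e, f e) 0})"
    using derivable_arc_value[OF X C(2), of e "f e" K] amo f insert.prems
    by (simp add: insert_commute)
  ultimately have "derivable X K (Pow (box_eqs p C T)) (insert (?L1 + ?L2) (?c A \<union> {var_eq (e, f e) 0}))"
    using insert by (intro derivable_resolution_add) auto
  then show ?case unfolding eq by simp
qed

text \<open>Case analysis over all value tuples \<open>f\<close> on \<open>T\<close>: either the
  total under \<open>f\<close> lies in \<open>W\<close>, or a given clause excludes
  \<open>f\<close>. The clauses for the tuples are then resolved away, one arc at a time, with the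
  at-least-one clauses.\<close>

lemma derivable_flow_values:
  assumes X: "T \<times> {..<p} \<subseteq> X" and C: "card T * p \<le> C" "p \<le> C" "0 < p" and T: "finite T"
    and W: "\<And>b. b \<in> W \<Longrightarrow> \<bar>b\<bar> \<le> int C" "T = {} \<Longrightarrow> 0 \<notin> W"
    and alo: "\<And>e. e \<in> T \<Longrightarrow> derivable X K (Pow (box_eqs p C T)) {var_eq (e, i) 1 |i. i < p}"
    and amo: "\<And>e i j. e \<in> T \<Longrightarrow> i < p \<Longrightarrow> j < p \<Longrightarrow> j \<noteq> i \<Longrightarrow>
      derivable X K (Pow (box_eqs p C T)) {var_eq (e, i) 0, var_eq (e, j) 0}"
    and clauses: "\<And>f. (\<And>e. e \<in> T \<Longrightarrow> f e < p) \<Longrightarrow> int (\<Sum>e\<in>T. f e) \<notin> W \<Longrightarrow>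
      derivable X K (Pow (box_eqs p C T)) ((\<lambda>e. var_eq (e, f e) 0) ` T)"
  shows "derivable X K (Pow (box_eqs p C T)) (Pair (flow p T) ` W)"
proof -
  let ?D = "derivable X K (Pow (box_eqs p C T))"
  let ?c = "\<lambda>f A. (\<lambda>e. var_eq (e, f e) (0::int)) ` A"
  let ?M = "Pair (flow p T) ` W"
  have "W \<subseteq> {-int C..int C}" using W(1) by force
  then have fin_W: "finite W" by (rule finite_subset) simp
  have M: "?M \<subseteq> box_eqs p C T"
    using W(1) T by (auto intro: flow_in_box_eqs)
  have c: "?c f A \<subseteq> box_eqs p C T" if "A \<subseteq> T" "\<And>e. e \<in> T \<Longrightarrow> f e < p" for f A
    using that by (intro image_subsetI var_eq_in_box_eqs) auto
  have weaken: "?D (A \<union> B)" if "?D A" "finite B" "B \<subseteq> box_eqs p C T" "A \<subseteq> box_eqs p C T" for A B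
  proof (rule derivable_weakening_set[OF that(1,2)])
    show "eq_vars L \<subseteq> X" if "L \<in> B" for L
      using that \<open>B \<subseteq> _\<close> eq_vars_box_eqs[of L p C T] X by blast
  qed (use that in auto)
  have all: "?D (?c f T \<union> ?M)" if f: "\<And>e. e \<in> T \<Longrightarrow> f e < p" for f
  proof (cases "int (\<Sum>e\<in>T. f e) \<in> W")
    case True
    \<comment> \<open>\<open>derivable_clause_or_flow\<close> needs an arc; for empty
      \<open>T\<close> the total is 0, which is not in \<open>W\<close>, so that situation belongs
      to the other case.\<close>
    then have "T \<noteq> {}" using W(2) by auto
    then have "?D (insert (flow p T, int (\<Sum>e\<in>T. f e)) (?c f T))"
      using derivable_clause_or_flow[OF X C(1,2) T amo f, where A = T] by simp
    then have "?D (insert (flow p T, int (\<Sum>e\<in>T. f e)) (?c f T) \<union> ?M)"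
      using True M c[OF subset_refl f] fin_W by (intro weaken) auto
    moreover have "insert (flow p T, int (\<Sum>e\<in>T. f e)) (?c f T) \<union> ?M = ?c f T \<union> ?M"
      using True by auto
    ultimately show ?thesis by simp
  next
    case False
    then show ?thesis
      using clauses[OF f] M c[OF subset_refl f] fin_W by (intro weaken) auto
  qed
  \<comment> \<open>\<open>A\<close> is the set of arcs still mentioned by the clauses; each
    induction step removes one arc \<open>e\<close> for all tuples at once.\<close>
  have elim: "A \<subseteq> T \<Longrightarrow> (\<And>f. (\<And>e. e \<in> T \<Longrightarrow> f e < p) \<Longrightarrow> ?D (?c f A \<union> ?M)) \<Longrightarrow> ?D ?M" if "finite A" for A
    using that
  proof (induction A rule: finite_induct)
    case empty
    from empty(2)[of "\<lambda>_. 0"] C(3) show ?case by simp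
  next
    case (insert e A)
    have "?D (?c f A \<union> ?M)" if f: "\<And>e. e \<in> T \<Longrightarrow> f e < p" for f
    proof -
      let ?R = "\<lambda>i. (\<lambda>j. var_eq (e, j) (1::int)) ` {i..<p}"
      have R: "?R i \<subseteq> box_eqs p C T" for i
        using insert.prems C by (intro image_subsetI var_eq_in_box_eqs) auto
      \<comment> \<open>After \<open>i\<close> rounds the alternatives \<open>(e, j) = 1\<close>
        with \<open>j < i\<close> are gone; at \<open>i = p\<close> none is left.\<close>
      have "?D (?R i \<union> (?c f A \<union> ?M))" if "i \<le> p" for i
        using that
      proof (induction i)
        case 0
        have "{var_eq (e, i) 1 |i. i < p} = ?R 0" by auto
        then show ?case
          using alo[of e] insert.prems insert.hyps fin_W M c[of A f] f R[of 0]
          by (intro weaken) auto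
      next
        case (Suc i)
        have "?D (?c (f(e := i)) (insert e A) \<union> ?M)"
          using f Suc.prems by (intro insert.prems(2)) auto
        also have "?c (f(e := i)) (insert e A) = insert (var_eq (e, i) 0) (?c f A)"
          using insert.hyps(2) by auto
        finally have 2: "?D (insert (var_eq (e, i) 0) (?c f A \<union> ?M))" by simp
        have "{i..<p} = insert i {Suc i..<p}" using Suc.prems by auto
        then have 1: "?D (insert (var_eq (e, i) 1) (?R (Suc i) \<union> (?c f A \<union> ?M)))"
          using Suc by simp
        have sub: "?R (Suc i) \<union> (?c f A \<union> ?M) \<subseteq> box_eqs p C T"
          using R M c[of A f] f insert.prems by simp
        \<comment> \<open>Clause resolution on a variable is simulated by subtraction: the clashing
          equations yield 0 = 1, which simplification deletes.\<close>
        have diff: "var_eq (e, i) 1 - var_eq (e, i) 0 = (0, 1)"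
          by (simp add: var_eq_def)
        have "?D (insert (var_eq (e, i) 1 - var_eq (e, i) 0)
            ((?R (Suc i) \<union> (?c f A \<union> ?M)) \<union> (?c f A \<union> ?M)))"
          using sub C by (intro derivable_resolution_diff[OF 1 2]) (auto simp: diff box_eqs_def)
        then have "?D (insert (0, 1) (?R (Suc i) \<union> (?c f A \<union> ?M)))"
          unfolding diff by (simp add: Un_assoc)
        then show ?case
          using sub by (elim derivable_simplification) auto
      qed
      from this[of p] show ?thesis by simp
    qed
    then show ?case using insert by simp
  qed
  show ?thesis by (rule elim[OF T subset_refl all])
qed


section \<open>Adding and subtracting lines\<close>

text \<open>
  The lines of the derivation of all sums (differences) of a value of \<open>F\<close> and a value of \<open>G\<close>;
  the thresholds leave only cubically many of them.
\<close>

definition value_line :: "('v \<Rightarrow>\<^sub>0 int) \<Rightarrow> ('v \<Rightarrow>\<^sub>0 int) \<Rightarrow> ('v \<Rightarrow>\<^sub>0 int) \<Rightarrow>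
    int set \<Rightarrow> int set \<Rightarrow> int set \<Rightarrow> int \<Rightarrow> int \<Rightarrow> int \<Rightarrow> 'v disj" where
  "value_line F G H U V W \<beta> \<gamma> \<delta> =
     Pair F ` (U \<inter> {\<beta>..}) \<union> Pair G ` (V \<inter> {\<gamma>..}) \<union> Pair H ` (W \<inter> {..<\<delta>})"

lemma Int_atLeast_step:
  fixes \<beta> :: int
  shows "U \<inter> {\<beta>..} = (if \<beta> \<in> U then insert \<beta> (U \<inter> {\<beta> + 1..}) else U \<inter> {\<beta> + 1..})"
  by (auto simp: order_le_less zless_imp_add1_zle)

lemma Int_lessThan_step:
  fixes \<delta> :: int
  shows "W \<inter> {..<\<delta> + 1} = (if \<delta> \<in> W then insert \<delta> (W \<inter> {..<\<delta>}) else W \<inter> {..<\<delta>})"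
  by (auto simp: order_le_less)

text \<open>Two nested loops. The outer one deletes the values of \<open>F\<close> in increasing
  order; for each of them the inner one resolves it against every value of \<open>G\<close>. The
  resolvents are all values of \<open>H\<close>, present in the line from the start by weakening.
  The rule \<open>res\<close> covers addition and subtraction alike.\<close>

lemma derivable_combination:
  fixes B :: int
  assumes res: "\<And>A A' b c. derivable X K \<Lambda> (insert (F, b) A) \<Longrightarrow> derivable X K \<Lambda> (insert (G, c) A') \<Longrightarrow>
      insert (H, g b c) (A \<union> A') \<in> \<Lambda> \<Longrightarrow> derivable X K \<Lambda> (insert (H, g b c) (A \<union> A'))"
    and B: "0 \<le> B" "U \<subseteq> {-B..B}" "V \<subseteq> {-B..B}" "W \<subseteq> {-B..B}"
    and g: "\<And>b c. b \<in> U \<Longrightarrow> c \<in> V \<Longrightarrow> g b c \<in> W"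
    and X: "Poly_Mapping.keys F \<subseteq> X" "Poly_Mapping.keys H \<subseteq> X"
    and lines: "\<And>\<beta> \<gamma> \<delta>. {\<beta>, \<gamma>, \<delta>} \<subseteq> {-B..B + 1} \<Longrightarrow> value_line F G H U V W \<beta> \<gamma> \<delta> \<in> \<Lambda>"
    and F: "derivable X K \<Lambda> (Pair F ` U)" and G: "derivable X K \<Lambda> (Pair G ` V)"
  shows "derivable X K \<Lambda> (Pair H ` W)"
proof -
  let ?D = "derivable X K \<Lambda>"
  let ?l = "value_line F G H U V W"
  \<comment> \<open>At \<open>-B\<close> the lower thresholds cut off nothing and at
    \<open>B + 1\<close> everything; for the upper threshold of \<open>W\<close> it is the
    reverse.\<close>
  have full: "U \<inter> {-B..} = U" "V \<inter> {-B..} = V" "W \<inter> {..<B + 1} = W"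
    "U \<inter> {B + 1..} = {}" "V \<inter> {B + 1..} = {}" "W \<inter> {..<-B} = {}"
    using B by fastforce+
  have up: "?D (?l \<beta> \<gamma> \<delta>)" if "?D (?l \<beta> \<gamma> (-B))" "-B \<le> \<delta>" "\<delta> \<le> B + 1" "{\<beta>, \<gamma>} \<subseteq> {-B..B + 1}"
    for \<beta> \<gamma> \<delta>
    using that(2,3)
  proof (induction \<delta> rule: int_ge_induct)
    case base
    then show ?case using that(1) by simp
  next
    case (step \<delta>)
    have eq: "?l \<beta> \<gamma> (\<delta> + 1) = (if \<delta> \<in> W then insert (H, \<delta>) (?l \<beta> \<gamma> \<delta>) else ?l \<beta> \<gamma> \<delta>)"
      by (auto simp: value_line_def Int_lessThan_step)
    show ?case
      using step lines[of \<beta> \<gamma> "\<delta> + 1"] that(4) X unfolding eq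
      by (auto intro!: derivable_weakening simp: eq_vars_def)
  qed
  have F1: "?D (?l (-B) (B + 1) (B + 1))"
    using up[of "-B" "B + 1" "B + 1"] F B(1) by (simp add: value_line_def full)
  have G0: "?D (?l (B + 1) (-B) (B + 1))"
    using up[of "B + 1" "-B" "B + 1"] G B(1) by (simp add: value_line_def full)
  \<comment> \<open>The line for \<open>G\<close> also receives the values of \<open>F\<close> that
    are still open, so that each resolvent is again a value line.\<close>
  have G1: "?D (?l \<beta> (-B) (B + 1))" if "\<beta> \<le> B + 1" "-B \<le> \<beta>" for \<beta>
    using that
  proof (induction \<beta> rule: int_le_induct)
    case base
    then show ?case using G0 by simp
  next
    case (step \<beta>)
    have eq: "?l (\<beta> - 1) (-B) (B + 1) =
        (if \<beta> - 1 \<in> U then insert (F, \<beta> - 1) (?l \<beta> (-B) (B + 1)) else ?l \<beta> (-B) (B + 1))"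
      by (auto simp: value_line_def Int_atLeast_step[of U "\<beta> - 1"])
    show ?case
      using step lines[of "\<beta> - 1" "-B" "B + 1"] B X unfolding eq
      by (auto intro!: derivable_weakening simp: eq_vars_def)
  qed
  have "?D (?l \<beta> (B + 1) (B + 1))" if "-B \<le> \<beta>" "\<beta> \<le> B + 1" for \<beta>
    using that
  proof (induction \<beta> rule: int_ge_induct)
    case base
    then show ?case using F1 by simp
  next
    case (step \<beta>)
    have eqF: "?l \<beta> (B + 1) (B + 1) =
        (if \<beta> \<in> U then insert (F, \<beta>) (?l (\<beta> + 1) (B + 1) (B + 1)) else ?l (\<beta> + 1) (B + 1) (B + 1))"
      by (auto simp: value_line_def Int_atLeast_step[of U \<beta>])
    show ?case
    proof (cases "\<beta> \<in> U")
      case False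
      then show ?thesis using step eqF by simp
    next
      case True
      have Fb: "?D (insert (F, \<beta>) (?l (\<beta> + 1) (B + 1) (B + 1)))"
        using step eqF True by simp
      \<comment> \<open>Inner loop: with \<open>\<beta>\<close> fixed, \<open>\<gamma>\<close> runs
        upwards until all values of \<open>G\<close> are eliminated, which leaves the line without
        \<open>\<beta>\<close>.\<close>
      have "?D (?l (\<beta> + 1) \<gamma> (B + 1))" if "-B \<le> \<gamma>" "\<gamma> \<le> B + 1" for \<gamma>
        using that
      proof (induction \<gamma> rule: int_ge_induct)
        case base
        then show ?case using G1 step by simp
      next
        case (step \<gamma>)
        let ?E = "?l (\<beta> + 1) (\<gamma> + 1) (B + 1)"
        have eqG: "?l (\<beta> + 1) \<gamma> (B + 1) = (if \<gamma> \<in> V then insert (G, \<gamma>) ?E else ?E)"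
          by (auto simp: value_line_def Int_atLeast_step[of V \<gamma>])
        show ?case
        proof (cases "\<gamma> \<in> V")
          case False
          then show ?thesis using step eqG by simp
        next
          case True
          have "(H, g \<beta> \<gamma>) \<in> ?E"
            using g[OF \<open>\<beta> \<in> U\<close> True] by (simp add: value_line_def full)
          then have E: "insert (H, g \<beta> \<gamma>) (?l (\<beta> + 1) (B + 1) (B + 1) \<union> ?E) = ?E"
            by (auto simp: value_line_def full)
          have "?D (insert (G, \<gamma>) ?E)" using step eqG True by simp
          from res[OF Fb this] show ?thesis
            unfolding E using lines[of "\<beta> + 1" "\<gamma> + 1" "B + 1"] step \<open>-B \<le> \<beta>\<close> \<open>\<beta> + 1 \<le> B + 1\<close> by simp
        qed
      qed
      from this[of "B + 1"] B(1) show ?thesis by simp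
    qed
  qed
  from this[of "B + 1"] B(1) show ?thesis by (simp add: value_line_def full)
qed

section \<open>Sizes and numbers of value lines\<close>

lemma eq_size_le:
  assumes "Poly_Mapping.keys F \<subseteq> V" "finite V" "\<And>x. \<bar>Poly_Mapping.lookup F x\<bar> \<le> int c" "\<bar>b\<bar> \<le> int B"
  shows "eq_size (F, b) \<le> card V * c + B"
proof -
  have "(\<Sum>x\<in>Poly_Mapping.keys F. nat \<bar>Poly_Mapping.lookup F x\<bar>) \<le> card (Poly_Mapping.keys F) * c"
    using sum_bounded_above[of "Poly_Mapping.keys F" "\<lambda>x. nat \<bar>Poly_Mapping.lookup F x\<bar>" c] assms(3)
    by (simp add: nat_le_iff)
  also have "\<dots> \<le> card V * c"
    using card_mono[OF assms(2,1)] by simp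
  finally show ?thesis using assms(4) by (simp add: eq_size_def)
qed

lemma good_lineI:
  assumes "finite D" "card (fst ` D) \<le> k" "card D \<le> N" "finite V"
    "\<And>F b. (F, b) \<in> D \<Longrightarrow> Poly_Mapping.keys F \<subseteq> V \<and> (\<forall>x. \<bar>Poly_Mapping.lookup F x\<bar> \<le> int c) \<and> \<bar>b\<bar> \<le> int B"
    "N * (card V * c + B) \<le> s"
  shows "good_line c k s D"
proof -
  have "eq_size L \<le> card V * c + B" if "L \<in> D" for L
    using eq_size_le[of "fst L" V c "snd L" B] assms(4,5) that by (metis prod.collapse)
  then have "disj_size D \<le> s"
    using disj_size_le[OF assms(1,3)] assms(6) le_trans by blast
  moreover have "R0lin_line c k D"
    using assms(1,2,5) by (intro R0lin_lineI) auto
  ultimately show ?thesis by (simp add: good_line_def)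
qed

text \<open>Three left-hand sides with at most \<open>2 * B + 1\<close> free terms each, and each
  equation of size at most \<open>card V * c + B\<close>.\<close>

lemma value_line_good:
  assumes "U \<subseteq> {-int B..int B}" "U' \<subseteq> {-int B..int B}" "W \<subseteq> {-int B..int B}" "finite V"
    and "\<And>F'. F' \<in> {F, G, H} \<Longrightarrow>
      Poly_Mapping.keys F' \<subseteq> V \<and> (\<forall>x. \<bar>Poly_Mapping.lookup F' x\<bar> \<le> int c)"
    and "3 \<le> k" "3 * (2 * B + 1) * (card V * c + B) \<le> s"
  shows "good_line c k s (value_line F G H U U' W \<beta> \<gamma> \<delta>)"
proof (rule good_lineI[OF _ _ _ assms(4) _ assms(7)])
  let ?D = "value_line F G H U U' W \<beta> \<gamma> \<delta>"
  let ?M = "{F, G, H} \<times> {-int B..int B}"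
  have sub: "?D \<subseteq> ?M" using assms(1-3) unfolding value_line_def by blast
  have 3: "card {F, G, H} \<le> 3" by (simp add: card_insert_if)
  show "finite ?D" using sub by (rule finite_subset) simp
  have "card (fst ` ?D) \<le> card {F, G, H}"
    using sub by (intro card_mono) auto
  then show "card (fst ` ?D) \<le> k" using 3 assms(6) by linarith
  have "card ?D \<le> card ?M" using sub by (intro card_mono) simp_all
  also have "\<dots> \<le> 3 * (2 * B + 1)"
    unfolding card_cartesian_product using 3 by (intro mult_le_mono) simp_all
  finally show "card ?D \<le> 3 * (2 * B + 1)" .
  show "Poly_Mapping.keys F' \<subseteq> V \<and> (\<forall>x. \<bar>Poly_Mapping.lookup F' x\<bar> \<le> int c) \<and> \<bar>b\<bar> \<le> int B"
    if "(F', b) \<in> ?D" for F' b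
    using subsetD[OF sub that] assms(5) by (auto simp: abs_le_iff)
qed

lemma provable_combination:
  assumes "provable c k s X K m1 (Pair F ` U)" "provable c k s X K m2 (Pair G ` U')"
    and gH: "(\<forall>b c. (H, g b c) = (F, b) + (G, c)) \<or> (\<forall>b c. (H, g b c) = (F, b) - (G, c))"
    and W: "U \<subseteq> {-int B..int B}" "U' \<subseteq> {-int B..int B}" "W \<subseteq> {-int B..int B}"
    and g: "\<And>b c. b \<in> U \<Longrightarrow> c \<in> U' \<Longrightarrow> g b c \<in> W"
    and V: "finite V" "V \<subseteq> X"
    and forms: "\<And>F'. F' \<in> {F, G, H} \<Longrightarrow>
      Poly_Mapping.keys F' \<subseteq> V \<and> (\<forall>x. \<bar>Poly_Mapping.lookup F' x\<bar> \<le> int c)"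
    and ks: "3 \<le> k" "3 * (2 * B + 1) * (card V * c + B) \<le> s"
  shows "provable c k s X K (m1 + m2 + (2 * B + 2) ^ 3) (Pair H ` W)"
proof (rule provable_combine[OF assms(1,2)])
  \<comment> \<open>Each of the three thresholds takes \<open>2 * B + 2\<close> values, whence the
    cubic number of lines.\<close>
  let ?I = "{-int B..int B + 1}"
  let ?f = "\<lambda>(\<beta>, \<gamma>, \<delta>). value_line F G H U U' W \<beta> \<gamma> \<delta>"
  let ?\<Lambda> = "?f ` (?I \<times> ?I \<times> ?I)"
  show "finite ?\<Lambda>" by simp
  have "card ?I = 2 * B + 2" by simp
  then have "card (?I \<times> ?I \<times> ?I) = (2 * B + 2) ^ 3"
    by (simp only: card_cartesian_product power3_eq_cube mult.assoc)
  moreover have "card ?\<Lambda> \<le> card (?I \<times> ?I \<times> ?I)" by (intro card_image_le) simp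
  ultimately show "card ?\<Lambda> \<le> (2 * B + 2) ^ 3" by (simp only:)
  show "good_line c k s E" if "E \<in> ?\<Lambda>" for E
    using that value_line_good[OF W V(1) forms ks] by auto
  fix \<Lambda>' assume \<Lambda>': "?\<Lambda> \<subseteq> \<Lambda>'" and D: "derivable X K \<Lambda>' (Pair F ` U)" "derivable X K \<Lambda>' (Pair G ` U')"
  show "derivable X K \<Lambda>' (Pair H ` W)"
  proof (rule derivable_combination[where B = "int B", OF _ _ W g _ _ _ D])
    show "derivable X K \<Lambda>' (insert (H, g b c) (A \<union> A'))"
      if "derivable X K \<Lambda>' (insert (F, b) A)" "derivable X K \<Lambda>' (insert (G, c) A')"
        "insert (H, g b c) (A \<union> A') \<in> \<Lambda>'" for A A' b c
      using gH derivable_resolution_add[OF that(1,2)] derivable_resolution_diff[OF that(1,2)] that(3)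
      by metis
    show "value_line F G H U U' W \<beta> \<gamma> \<delta> \<in> \<Lambda>'" if "{\<beta>, \<gamma>, \<delta>} \<subseteq> {-int B..int B + 1}" for \<beta> \<gamma> \<delta>
      by (rule subsetD[OF \<Lambda>' image_eqI[where x = "(\<beta>, \<gamma>, \<delta>)"]]) (use that in auto)
  qed (use forms V in auto)
qed

text \<open>With no variables left, every equation reads 0 = b with nonzero b, and simplification
  deletes them in increasing order. The count \<open>m\<close> appears twice because
  \<open>provable_combine\<close> takes two premises and receives the same one for both.\<close>

lemma provable_simplify:
  assumes "provable c k s X K m (Pair 0 ` U)" "U \<subseteq> {-int B..int B}" "0 \<notin> U"
    and "3 \<le> k" "3 * (2 * B + 1) * B \<le> s"
  shows "provable c k s X K (m + m + (2 * B + 2)) {}"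
proof (rule provable_combine[OF assms(1,1)])
  let ?l = "\<lambda>\<beta>. Pair 0 ` (U \<inter> {\<beta>..}) :: 'a disj"
  let ?\<Lambda> = "?l ` {-int B..int B + 1}"
  show "finite ?\<Lambda>" by simp
  have "card ?\<Lambda> \<le> card {-int B..int B + 1}" by (intro card_image_le) simp
  then show "card ?\<Lambda> \<le> 2 * B + 2" by (simp add: nat_add_distrib)
  show "good_line c k s E" if "E \<in> ?\<Lambda>" for E
    \<comment> \<open>Such a line is a value line whose other two value sets are empty, so the
      earlier size bound applies, with no variables.\<close>
    using that value_line_good[of U B "{}" "{}" "{}" 0 0 0 c k s _ 0 0] assms(2,4,5)
    by (auto simp: value_line_def)
  fix \<Lambda>' assume \<Lambda>': "?\<Lambda> \<subseteq> \<Lambda>'" and D: "derivable X K \<Lambda>' (Pair 0 ` U)"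
  have "derivable X K \<Lambda>' (?l \<beta>)" if "-int B \<le> \<beta>" "\<beta> \<le> int B + 1" for \<beta>
    using that
  proof (induction \<beta> rule: int_ge_induct)
    case base
    have "U \<inter> {- int B..} = U" using assms(2) by auto
    then show ?case using D by simp
  next
    case (step \<beta>)
    show ?case
    proof (cases "\<beta> \<in> U")
      case True
      then have "?l \<beta> = insert (0, \<beta>) (?l (\<beta> + 1))" by (simp add: Int_atLeast_step[of U \<beta>])
      then have "derivable X K \<Lambda>' (insert (0, \<beta>) (?l (\<beta> + 1)))" using step by simp
      then show ?thesis
      proof (rule derivable_simplification)
        show "\<beta> \<noteq> 0" using True assms(3) by blast
        show "?l (\<beta> + 1) \<in> \<Lambda>'" using step by (intro subsetD[OF \<Lambda>'] imageI) simp
      qed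
    next
      case False
      then show ?thesis using step by (simp add: Int_atLeast_step[of U \<beta>])
    qed
  qed
  from this[of "int B + 1"] have "derivable X K \<Lambda>' (?l (int B + 1))" by simp
  moreover have "U \<inter> {int B + 1..} = {}" using assms(2) by auto
  ultimately show "derivable X K \<Lambda>' {}" by simp
qed


section \<open>Counting the local lines\<close>

text \<open>An equation in the box is determined by its coefficients on
  \<open>T \<times> {..<p}\<close>, with \<open>p + 1\<close> choices each, and by its free term,
  with \<open>2 * C + 1\<close> choices.\<close>

lemma finite_card_box_eqs:
  fixes T :: "'b set"
  assumes "finite T" "card T \<le> h"
  shows "finite (box_eqs p C T) \<and> card (box_eqs p C T) \<le> (p + 1) ^ (h * p) * (2 * C + 1)"
proof -
  let ?V = "T \<times> {..<p}"
  let ?M = "(?V \<rightarrow>\<^sub>E {0..int p}) \<times> {-int C..int C}"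
  let ?f = "\<lambda>(F, b). (restrict (Poly_Mapping.lookup F) ?V, b)"
  have inj: "inj_on ?f (box_eqs p C T)"
  proof (rule inj_onI)
    fix L L' assume L: "L \<in> box_eqs p C T" "L' \<in> box_eqs p C T" "?f L = ?f L'"
    obtain F b F' b' where FF: "L = (F, b)" "L' = (F', b')"
      by (cases L, cases L') blast
    have F: "(F, b) \<in> box_eqs p C T" "(F', b') \<in> box_eqs p C T" and b: "b = b'"
      and eq: "restrict (Poly_Mapping.lookup F) ?V = restrict (Poly_Mapping.lookup F') ?V"
      using L unfolding FF by simp_all
    have "Poly_Mapping.lookup F x = Poly_Mapping.lookup F' x" for x
    proof (cases "x \<in> ?V")
      case True
      then show ?thesis using fun_cong[OF eq, of x] by simp
    next
      case False
      then have "x \<notin> Poly_Mapping.keys F" "x \<notin> Poly_Mapping.keys F'"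
        using F unfolding box_eqs_def by blast+
      then show ?thesis by (simp add: in_keys_iff)
    qed
    then show "L = L'" unfolding FF b by (simp add: poly_mapping_eqI)
  qed
  have sub: "?f ` box_eqs p C T \<subseteq> ?M"
    by (force simp: box_eqs_def)
  have fin: "finite ?M" using assms(1) by (intro finite_cartesian_product finite_PiE) auto
  have "card ?M = (p + 1) ^ (card T * p) * (2 * C + 1)"
    using assms(1) by (simp add: card_PiE card_cartesian_product nat_add_distrib)
  also have "\<dots> \<le> (p + 1) ^ (h * p) * (2 * C + 1)"
    using assms(2) by (intro mult_le_mono1 power_increasing) auto
  finally show ?thesis
    using inj_on_finite[OF inj sub fin] card_inj_on_le[OF inj sub fin] by linarith
qed

text \<open>All subsets of the box serve as lines. There are at most \<open>2 ^ N\<close> of them,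
  each with at most \<open>N\<close> left-hand sides, and \<open>N\<close> is chosen from constants
  only.\<close>

lemma provable_local:
  assumes "derivable X K (Pow (box_eqs p C T)) D" "finite T" "card T \<le> h"
    "(p + 1) ^ (h * p) * (2 * C + 1) \<le> N" "N \<le> k" "N * (h * p * p + C) \<le> s"
  shows "provable p k s X K (2 ^ N) D"
proof -
  let ?E = "box_eqs p C T"
  have fin: "finite ?E" and card: "card ?E \<le> N"
    using finite_card_box_eqs[OF assms(2,3), of p C] assms(4) by auto
  have "good_line p k s D" if "D \<subseteq> ?E" for D
  proof (rule good_lineI)
    show D: "finite D" using that fin by (rule finite_subset)
    show "card D \<le> N" using card_mono[OF fin that] card by linarith
    then show "card (fst ` D) \<le> k" using card_image_le[OF D, of fst] assms(5) by linarith
    show "finite (T \<times> {..<p})" using assms(2) by simp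
    show "Poly_Mapping.keys F \<subseteq> T \<times> {..<p} \<and> (\<forall>x. \<bar>Poly_Mapping.lookup F x\<bar> \<le> int p) \<and> \<bar>b\<bar> \<le> int C"
      if "(F, b) \<in> D" for F b
      using subsetD[OF \<open>D \<subseteq> ?E\<close> that] by (simp add: box_eqs_def)
    have "N * (card (T \<times> {..<p}) * p + C) \<le> N * (h * p * p + C)"
      using assms(3) by (simp add: card_cartesian_product)
    then show "N * (card (T \<times> {..<p}) * p + C) \<le> s" using assms(6) by linarith
  qed
  moreover have "card (Pow ?E) \<le> 2 ^ N"
    using card by (simp add: card_Pow[OF fin] power_increasing)
  ultimately show ?thesis
    using assms(1) fin unfolding provable_def by (intro exI[of _ "Pow ?E"]) auto
qed

text \<open>The index \<open>j\<close> counts the local facts combined so far. Each contributes at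
  most \<open>C\<close> to the free term, so the window grows linearly.\<close>

definition residues :: "nat \<Rightarrow> nat \<Rightarrow> nat \<Rightarrow> int \<Rightarrow> int set" where
  "residues p C j \<rho> = {b. \<bar>b\<bar> \<le> int (C * j) \<and> [b = \<rho>] (mod int p)}"

lemma residues_subset: "j \<le> J \<Longrightarrow> residues p C j \<rho> \<subseteq> {-int (C * J)..int (C * J)}"
proof -
  assume "j \<le> J"
  then have "int (C * j) \<le> int (C * J)" by (intro of_nat_mono mult_le_mono2)
  then show ?thesis unfolding residues_def by force
qed

lemma residues_add:
  "b \<in> residues p C i \<rho> \<Longrightarrow> c \<in> residues p C j \<sigma> \<Longrightarrow> b + c \<in> residues p C (i + j) (\<rho> + \<sigma>)"
  by (auto simp: residues_def cong_add algebra_simps)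

lemma residues_diff:
  "b \<in> residues p C i \<rho> \<Longrightarrow> c \<in> residues p C j \<sigma> \<Longrightarrow> b - c \<in> residues p C (i + j) (\<rho> - \<sigma>)"
  by (auto simp: residues_def cong_diff algebra_simps)

lemma provable_mono:
  "provable c k s X K m D \<Longrightarrow> m \<le> m' \<Longrightarrow> provable c k s X K m' D"
  unfolding provable_def using le_trans by blast

lemma flow_form:
  assumes "finite A" "A \<subseteq> E"
  shows "Poly_Mapping.keys (flow p A) \<subseteq> E \<times> {..<p} \<and>
    (\<forall>x. \<bar>Poly_Mapping.lookup (flow p A) x\<bar> \<le> int p)"
  using keys_flow[OF assms(1), of p] assms by (auto simp: lookup_flow)

text \<open>\<open>J\<close> is a common bound on the number of combined facts, so one line size
  \<open>s\<close> serves all steps. Disjointness, respectively inclusion, makes the resulting form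
  a flow again, with bounded coefficients.\<close>

lemma provable_flow_combination:
  assumes A: "provable p k s (E \<times> {..<p}) K m1 (Pair (flow p A) ` residues p C i \<rho>)"
    and T: "provable p k s (E \<times> {..<p}) K m2 (Pair (flow p T) ` residues p C j \<sigma>)"
    and E: "finite E" "A \<subseteq> E" "T \<subseteq> E" and J: "i + j \<le> J"
    and ks: "3 \<le> k" "3 * (2 * (C * J) + 1) * (card E * p * p + C * J) \<le> s"
  shows "A \<inter> T = {} \<Longrightarrow> provable p k s (E \<times> {..<p}) K (m1 + m2 + (2 * (C * J) + 2) ^ 3)
      (Pair (flow p (A \<union> T)) ` residues p C (i + j) (\<rho> + \<sigma>))"
    and "T \<subseteq> A \<Longrightarrow> provable p k s (E \<times> {..<p}) K (m1 + m2 + (2 * (C * J) + 2) ^ 3)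
      (Pair (flow p (A - T)) ` residues p C (i + j) (\<rho> - \<sigma>))"
proof -
  have fin: "finite A" "finite T" using E finite_subset by auto
  have res: "residues p C i \<rho> \<subseteq> {-int (C * J)..int (C * J)}"
    "residues p C j \<sigma> \<subseteq> {-int (C * J)..int (C * J)}"
    "residues p C (i + j) \<tau> \<subseteq> {-int (C * J)..int (C * J)}" for \<tau>
    using J by (intro residues_subset; simp)+
  have s: "3 * (2 * (C * J) + 1) * (card (E \<times> {..<p}) * p + C * J) \<le> s"
    using ks(2) by (simp add: card_cartesian_product)
  have V: "finite (E \<times> {..<p})" using E(1) by simp
  have forms: "Poly_Mapping.keys (flow p Z) \<subseteq> E \<times> {..<p} \<and>
      (\<forall>x. \<bar>Poly_Mapping.lookup (flow p Z) x\<bar> \<le> int p)" if "Z \<in> {A, T, A \<union> T, A - T}" for Z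
    using that fin E by (intro flow_form) auto
  show "provable p k s (E \<times> {..<p}) K (m1 + m2 + (2 * (C * J) + 2) ^ 3)
      (Pair (flow p (A \<union> T)) ` residues p C (i + j) (\<rho> + \<sigma>))" if "A \<inter> T = {}"
  proof (rule provable_combination[OF A T _ res(1,2,3) residues_add V subset_refl _ ks(1) s])
    show "(\<forall>b c. (flow p (A \<union> T), b + c) = (flow p A, b) + (flow p T, c)) \<or>
        (\<forall>b c. (flow p (A \<union> T), b + c) = (flow p A, b) - (flow p T, c))"
      using flow_union_disjoint[OF fin that, of p] by simp
    show "Poly_Mapping.keys F \<subseteq> E \<times> {..<p} \<and> (\<forall>x. \<bar>Poly_Mapping.lookup F x\<bar> \<le> int p)"
      if "F \<in> {flow p A, flow p T, flow p (A \<union> T)}" for F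
      using that forms[of A] forms[of T] forms[of "A \<union> T"] by blast
  qed
  show "provable p k s (E \<times> {..<p}) K (m1 + m2 + (2 * (C * J) + 2) ^ 3)
      (Pair (flow p (A - T)) ` residues p C (i + j) (\<rho> - \<sigma>))" if "T \<subseteq> A"
  proof (rule provable_combination[OF A T _ res(1,2,3) residues_diff V subset_refl _ ks(1) s])
    show "(\<forall>b c. (flow p (A - T), b - c) = (flow p A, b) + (flow p T, c)) \<or>
        (\<forall>b c. (flow p (A - T), b - c) = (flow p A, b) - (flow p T, c))"
      using flow_diff[OF fin(1) that, of p] by simp
    show "Poly_Mapping.keys F \<subseteq> E \<times> {..<p} \<and> (\<forall>x. \<bar>Poly_Mapping.lookup F x\<bar> \<le> int p)"
      if "F \<in> {flow p A, flow p T, flow p (A - T)}" for F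
      using that forms[of A] forms[of T] forms[of "A - T"] by blast
  qed
qed

section \<open>The Tseitin formulas\<close>

lemma tseitin_at_least_one:
  "e \<in> arcs G \<Longrightarrow> {var_eq (e, i) 1 |i. i < p} \<in> neg_tseitin G p"
  unfolding neg_tseitin_def by blast

lemma tseitin_at_most_one:
  "e \<in> arcs G \<Longrightarrow> i < p \<Longrightarrow> j < p \<Longrightarrow> j \<noteq> i \<Longrightarrow> {var_eq (e, i) 0, var_eq (e, j) 0} \<in> neg_tseitin G p"
  unfolding neg_tseitin_def by blast

lemma tseitin_opposite:
  "opposite G e e' \<Longrightarrow> i < p \<Longrightarrow> {var_eq (e, i) 0, var_eq (e', (p - i) mod p) 1} \<in> neg_tseitin G p"
  unfolding neg_tseitin_def by blast

lemma tseitin_vertex: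
  "v \<in> verts G \<Longrightarrow> (\<And>e. e \<in> out_arcs G v \<Longrightarrow> f e < p) \<Longrightarrow>
    \<not> [(\<Sum>e\<in>out_arcs G v. f e) = 1] (mod p) \<Longrightarrow> (\<lambda>e. var_eq (e, f e) 0) ` out_arcs G v \<in> neg_tseitin G p"
  unfolding neg_tseitin_def setcompr_eq_image by blast

lemma derivable_tseitin_flow:
  assumes "2 \<le> p" "finite T" "T \<subseteq> arcs G" "card T * p \<le> C" "p \<le> C" "T = {} \<Longrightarrow> \<not> [0 = \<rho>] (mod int p)"
    and clauses: "\<And>f. (\<And>e. e \<in> T \<Longrightarrow> f e < p) \<Longrightarrow> \<not> [int (\<Sum>e\<in>T. f e) = \<rho>] (mod int p) \<Longrightarrow>
      derivable (tseitin_vars G p) (neg_tseitin G p) (Pow (box_eqs p C T)) ((\<lambda>e. var_eq (e, f e) 0) ` T)"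
  shows "derivable (tseitin_vars G p) (neg_tseitin G p) (Pow (box_eqs p C T))
    (Pair (flow p T) ` residues p C 1 \<rho>)"
proof (rule derivable_flow_values)
  let ?D = "derivable (tseitin_vars G p) (neg_tseitin G p) (Pow (box_eqs p C T))"
  have C: "1 \<le> int C" using assms(1,5) by linarith
  show "T \<times> {..<p} \<subseteq> tseitin_vars G p" using assms(3) by (auto simp: tseitin_vars_def)
  show "?D {var_eq (e, i) 1 |i. i < p}" if "e \<in> T" for e
    using that assms(3) C tseitin_at_least_one[of e G p]
    by (intro derivable_initial) (auto intro!: var_eq_in_box_eqs)
  show "?D {var_eq (e, i) 0, var_eq (e, j) 0}" if "e \<in> T" "i < p" "j < p" "j \<noteq> i" for e i j
    using that assms(3) C tseitin_at_most_one[of e G i p j]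
    by (intro derivable_initial) (auto intro!: var_eq_in_box_eqs)
  show "?D ((\<lambda>e. var_eq (e, f e) 0) ` T)"
    if f: "\<And>e. e \<in> T \<Longrightarrow> f e < p" and "int (\<Sum>e\<in>T. f e) \<notin> residues p C 1 \<rho>" for f
  proof -
    \<comment> \<open>The window contains every possible total, so a total outside
      \<open>residues\<close> must violate the congruence.\<close>
    have "(\<Sum>e\<in>T. f e) \<le> card T * p"
      using sum_bounded_above[of T f p] f by (force simp: less_imp_le)
    then have "\<bar>int (\<Sum>e\<in>T. f e)\<bar> \<le> int C" using assms(4) by linarith
    then show ?thesis
      using that clauses[OF f] by (simp add: residues_def)
  qed
qed (use assms in \<open>auto simp: residues_def\<close>)

section \<open>Opposite arcs, and the local facts for vertices and edges\<close>

lemma (in graph) ex_opposite: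
  assumes "e \<in> arcs G"
  obtains e' where "opposite G e e'"
proof -
  have "(tail G e, head G e) \<in> arcs_ends G"
    using assms by (auto simp: arcs_ends_def arc_to_ends_def)
  then have "(head G e, tail G e) \<in> arcs_ends G"
    using sym_arcs by (auto simp: symmetric_def dest: symD)
  then obtain e' where "e' \<in> arcs G" "tail G e' = head G e" "head G e' = tail G e"
    by (auto simp: arcs_ends_def arc_to_ends_def)
  then show thesis using assms that by (simp add: opposite_def)
qed

lemma (in graph) opposite_unique:
  "opposite G e e' \<Longrightarrow> opposite G e e'' \<Longrightarrow> e' = e''"
  by (rule no_multi_arcs) (auto simp: opposite_def arc_to_ends_def)

lemma (in graph) opposite_neq: "opposite G e e' \<Longrightarrow> e \<noteq> e'"
  using no_loops by (force simp: opposite_def)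

lemma opposite_sym: "opposite G e e' \<Longrightarrow> opposite G e' e"
  by (simp add: opposite_def)

lemma (in graph) derivable_vertex_flow:
  assumes "2 \<le> p" "v \<in> verts G" "card (out_arcs G v) * p \<le> C" "p \<le> C"
  shows "derivable (tseitin_vars G p) (neg_tseitin G p) (Pow (box_eqs p C (out_arcs G v)))
    (Pair (flow p (out_arcs G v)) ` residues p C 1 1)"
proof (rule derivable_tseitin_flow[OF assms(1) _ _ assms(3,4)])
  show "finite (out_arcs G v)" by (rule finite_subset[OF _ finite_arcs]) auto
  show "out_arcs G v \<subseteq> arcs G" by auto
  show "\<not> [0 = 1] (mod int p)" using assms(1) by (simp add: cong_def)
  fix f assume f: "\<And>e. e \<in> out_arcs G v \<Longrightarrow> f e < p"
    and "\<not> [int (\<Sum>e\<in>out_arcs G v. f e) = 1] (mod int p)"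
  then have "\<not> [(\<Sum>e\<in>out_arcs G v. f e) = 1] (mod p)"
    by (metis cong_int_iff of_nat_1)
  then show "derivable (tseitin_vars G p) (neg_tseitin G p) (Pow (box_eqs p C (out_arcs G v)))
      ((\<lambda>e. var_eq (e, f e) 0) ` out_arcs G v)"
    using f by (intro derivable_initial tseitin_vertex[OF assms(2)])
      (auto intro!: image_subsetI var_eq_in_box_eqs simp del: in_out_arcs_conv)
qed

text \<open>If the values do not cancel modulo \<open>p\<close>, then \<open>f e'\<close> differs
  from the value that \<open>f e\<close> forces on \<open>e'\<close>. The opposite-arc clause and an
  at-most-one clause on \<open>e'\<close> then exclude this pair of values.\<close>

lemma (in graph) derivable_edge_flow:
  assumes "2 \<le> p" "opposite G e e'" "2 * p \<le> C"
  shows "derivable (tseitin_vars G p) (neg_tseitin G p) (Pow (box_eqs p C {e, e'}))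
    (Pair (flow p {e, e'}) ` residues p C 1 0)"
proof (rule derivable_tseitin_flow[OF assms(1)])
  have neq: "e \<noteq> e'" using opposite_neq assms(2) .
  show "{e, e'} \<subseteq> arcs G" using assms(2) by (auto simp: opposite_def)
  show "card {e, e'} * p \<le> C" "p \<le> C" using neq assms(3) by simp_all
  fix f assume "\<And>e''. e'' \<in> {e, e'} \<Longrightarrow> f e'' < p"
  then have f: "f e < p" "f e' < p" by auto
  assume "\<not> [int (\<Sum>e''\<in>{e, e'}. f e'') = 0] (mod int p)"
  then have sum: "\<not> p dvd f e + f e'"
    using neq by (simp add: cong_0_iff flip: of_nat_add)
  let ?D = "derivable (tseitin_vars G p) (neg_tseitin G p) (Pow (box_eqs p C {e, e'}))"
  \<comment> \<open>The value forced on \<open>e'\<close>, namely the negative of \<open>f e\<close>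
    modulo \<open>p\<close>.\<close>
  let ?j = "(p - f e) mod p"
  have j: "?j < p" using assms(1) by simp
  have "?j \<noteq> f e'"
  proof
    assume "?j = f e'"
    then have "f e + f e' = 0 \<or> f e + f e' = p"
      using f by (cases "f e = 0") auto
    then show False using sum by auto
  qed
  have C: "1 \<le> int C" using assms(1,3) by linarith
  have box: "var_eq (e, i) b \<in> box_eqs p C {e, e'}" "var_eq (e', i) b \<in> box_eqs p C {e, e'}"
    if "i < p" "\<bar>b\<bar> \<le> 1" for i b
    using that C by (auto intro!: var_eq_in_box_eqs)
  have 1: "?D (insert (var_eq (e', ?j) 1) {var_eq (e, f e) 0})"
    using tseitin_opposite[OF assms(2) f(1)] box f j
    by (intro derivable_initial) (auto simp: insert_commute)
  have 2: "?D (insert (var_eq (e', ?j) 0) {var_eq (e', f e') 0})"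
    using tseitin_at_most_one[of e' G ?j p "f e'"] assms(2) box f j \<open>?j \<noteq> f e'\<close>
    by (intro derivable_initial) (auto simp: opposite_def)
  have diff: "var_eq (e', ?j) 1 - var_eq (e', ?j) 0 = (0, 1)"
    by (simp add: var_eq_def)
  have "?D (insert (0, 1) ({var_eq (e, f e) 0} \<union> {var_eq (e', f e') 0}))"
    using derivable_resolution_diff[OF 1 2] box f C unfolding diff by (simp add: box_eqs_def)
  then have "?D ({var_eq (e, f e) 0} \<union> {var_eq (e', f e') 0})"
    by (rule derivable_simplification) (use box f in auto)
  then show "?D ((\<lambda>e. var_eq (e, f e) 0) ` {e, e'})" by (simp add: insert_commute)
qed simp_all


text \<open>Vertex stars have \<open>r\<close> arcs and edges two, so \<open>r + 2\<close> bounds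
  both; \<open>C\<close> and \<open>N\<close> are the resulting box constants. \<open>N + 3\<close>
  suffices for local lines and for value lines. At most \<open>n + n * r\<close> facts are combined,
  each at cost \<open>M\<close>: one local derivation and one combination.\<close>

lemma (in graph) tseitin_refutation:
  assumes p: "2 \<le> p" and reg: "regular G r" and n: "card (verts G) = n" "[n = 1] (mod p)"
    and C: "C = (r + 2) * p" and N: "N = (p + 1) ^ ((r + 2) * p) * (2 * C + 1)"
    and B: "B = C * (n + n * r)"
    and s: "s = N * ((r + 2) * p * p + C) + 3 * (2 * B + 1) * (n * r * p * p + B)"
    and M: "M = 2 ^ N + (2 * B + 2) ^ 3"
  shows "\<exists>\<pi>. R0lin_refutation p (N + 3) (tseitin_vars G p) (neg_tseitin G p) \<pi> \<and>
    proof_size \<pi> \<le> ((n + n * r) * M + (n + n * r) * M + (2 * B + 2)) * s"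
proof -
  let ?J = "n + n * r"
  define P where "P m A j \<rho> \<longleftrightarrow> provable p (N + 3) s (arcs G \<times> {..<p}) (neg_tseitin G p) m
      (Pair (flow p A) ` residues p C j \<rho>)" for m A j \<rho>
  \<comment> \<open>This provides the first vertex for the nonempty induction below.\<close>
  have n0: "n \<noteq> 0"
    using n(2) p by (intro notI) (simp add: cong_def)
  have deg: "card (out_arcs G v) = r" if "v \<in> verts G" for v
    using reg that by (simp add: regular_def out_degree_def)
  have arcs: "arcs G = (\<Union>v\<in>verts G. out_arcs G v)" by auto
  have card_arcs: "card (arcs G) \<le> n * r"
    unfolding arcs using card_UN_le[OF finite_verts, of "out_arcs G"] deg n(1) by simp
  have local: "P (2 ^ N) T 1 \<rho>"
    if "derivable (tseitin_vars G p) (neg_tseitin G p) (Pow (box_eqs p C T))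
      (Pair (flow p T) ` residues p C 1 \<rho>)" "card T \<le> r + 2" "T \<subseteq> arcs G" for T \<rho>
    unfolding P_def
    using that finite_subset[OF that(3)] N s
    by (intro provable_local[where h = "r + 2" and C = C]) (auto simp: tseitin_vars_def)
  have ks: "3 \<le> N + 3" "3 * (2 * (C * ?J) + 1) * (card (arcs G) * p * p + C * ?J) \<le> s"
  proof -
    have "card (arcs G) * p * p \<le> n * r * p * p"
      using card_arcs by simp
    then have "3 * (2 * B + 1) * (card (arcs G) * p * p + B) \<le> 3 * (2 * B + 1) * (n * r * p * p + B)"
      by (intro mult_le_mono2 add_le_mono1)
    then show "3 * (2 * (C * ?J) + 1) * (card (arcs G) * p * p + C * ?J) \<le> s"
      unfolding s B[symmetric] by linarith
  qed simp
  have plus: "P (m + M) (A \<union> T) (j + 1) (\<rho> + \<sigma>)"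
    if "P m A j \<rho>" "P (2 ^ N) T 1 \<sigma>" "A \<subseteq> arcs G" "T \<subseteq> arcs G" "j + 1 \<le> ?J" "A \<inter> T = {}" for m A j \<rho> T \<sigma>
    using provable_flow_combination(1)[OF that(1,2)[unfolded P_def] finite_arcs that(3-5) ks that(6)]
    unfolding P_def M B by (simp add: add.assoc)
  have minus: "P (m + M) (A - T) (j + 1) (\<rho> - \<sigma>)"
    if "P m A j \<rho>" "P (2 ^ N) T 1 \<sigma>" "A \<subseteq> arcs G" "T \<subseteq> arcs G" "j + 1 \<le> ?J" "T \<subseteq> A" for m A j \<rho> T \<sigma>
    using provable_flow_combination(2)[OF that(1,2)[unfolded P_def] finite_arcs that(3-5) ks that(6)]
    unfolding P_def M B by (simp add: add.assoc)
  have vertex: "P (2 ^ N) (out_arcs G v) 1 1" if "v \<in> verts G" for v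
    using deg[OF that] C by (intro local derivable_vertex_flow[OF p that]) auto
  \<comment> \<open>Each arc leaves exactly one vertex, so the stars are disjoint and adding them
    keeps the coefficients bounded; the residue grows by 1 per vertex.\<close>
  have "P (card V * M) (\<Union>v\<in>V. out_arcs G v) (card V) (int (card V))"
    if "finite V" "V \<noteq> {}" "V \<subseteq> verts G" for V
    using that
  proof (induction V rule: finite_ne_induct)
    case (singleton v)
    then have "P (2 ^ N) (out_arcs G v) 1 1" using vertex by simp
    then have "P M (out_arcs G v) 1 1"
      unfolding P_def by (rule provable_mono) (simp add: M)
    then show ?case by simp
  next
    case (insert v V)
    have "card (insert v V) \<le> n" using card_mono[OF finite_verts insert.prems] n(1) by simp
    then have "P (card V * M + M) ((\<Union>v\<in>V. out_arcs G v) \<union> out_arcs G v) (card V + 1) (int (card V) + 1)"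
      using insert by (intro plus vertex) auto
    then show ?case
      using insert by (simp add: algebra_simps Un_commute)
  qed
  from this[of "verts G"] have all_verts: "P (n * M) (arcs G) n (int n)"
    using n(1) n0 arcs by fastforce
  define opp where "opp e = (SOME e'. opposite G e e')" for e
  \<comment> \<open>As a set of two-element sets this contains each undirected edge once, although
    it is indexed by arcs.\<close>
  define edges where "edges = (\<lambda>e. {e, opp e}) ` arcs G"
  have opp: "opposite G e (opp e)" if "e \<in> arcs G" for e
    unfolding opp_def by (rule ex_opposite[OF that]) (rule someI)
  have edges: "\<exists>e e'. T = {e, e'} \<and> opposite G e e'" if "T \<in> edges" for T
    using that opp by (auto simp: edges_def)
  \<comment> \<open>An arc has only one opposite because there are no parallel arcs, so pairs that
    share an arc coincide.\<close>
  have disj: "T = T'" if TT': "T \<in> edges" "T' \<in> edges" and x: "x \<in> T" "x \<in> T'" for T T' x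
  proof -
    have ex: "\<exists>y. T = {x, y} \<and> opposite G x y" if T: "T \<in> edges" "x \<in> T" for T
    proof -
      obtain e e' where e: "T = {e, e'}" "opposite G e e'" using edges[OF T(1)] by blast
      then consider "x = e" | "x = e'" using T(2) by blast
      then show ?thesis
        using e opposite_sym[OF e(2)] by cases (auto simp: insert_commute)
    qed
    obtain y y' where "T = {x, y}" "opposite G x y" "T' = {x, y'}" "opposite G x y'"
      using ex[OF TT'(1) x(1)] ex[OF TT'(2) x(2)] by blast
    then show ?thesis using opposite_unique[of x y y'] by simp
  qed
  have edge: "P (2 ^ N) T 1 0" "T \<subseteq> arcs G" if T: "T \<in> edges" for T
  proof -
    obtain e e' where e: "T = {e, e'}" "opposite G e e'" using edges[OF T] by blast
    then show "T \<subseteq> arcs G" by (auto simp: opposite_def)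
    then show "P (2 ^ N) T 1 0"
      using e derivable_edge_flow[OF p e(2), of C] C card_insert_le_m1[of 2 "{e'}" e]
      by (intro local) auto
  qed
  have fin_edges: "finite edges" and card_edges: "card edges \<le> n * r"
    using card_image_le[OF finite_arcs, of "\<lambda>e. {e, opp e}"] card_arcs
    by (auto simp: edges_def)
  \<comment> \<open>Subtracting an edge fact removes both its arcs and has residue 0, so the residue
    \<open>n\<close> survives until no arc is left.\<close>
  have "P ((n + card F) * M) (arcs G - \<Union>F) (n + card F) (int n)" if "finite F" "F \<subseteq> edges" for F
    using that
  proof (induction F rule: finite_induct)
    case empty
    then show ?case using all_verts by simp
  next
    case (insert T F)
    have "card (insert T F) \<le> n * r"
      using card_mono[OF fin_edges insert.prems] card_edges by linarith
    moreover have "T \<inter> \<Union>F = {}"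
      using disj insert.hyps(2) insert.prems by blast
    ultimately have "P ((n + card F) * M + M) (arcs G - \<Union>F - T) (n + card F + 1) (int n - 0)"
      using insert edge[of T] by (intro minus) auto
    moreover have "arcs G - \<Union>F - T = arcs G - \<Union>(insert T F)" by blast
    ultimately show ?case
      using insert by (simp add: algebra_simps)
  qed
  from this[OF fin_edges subset_refl]
  have "P ((n + card edges) * M) (arcs G - \<Union>edges) (n + card edges) (int n)" .
  moreover have "arcs G - \<Union>edges = {}" by (auto simp: edges_def)
  ultimately have "P ((n + card edges) * M) {} (n + card edges) (int n)" by simp
  then have zero: "provable p (N + 3) s (tseitin_vars G p) (neg_tseitin G p) (?J * M)
      (Pair 0 ` residues p C (n + card edges) (int n))"
    using card_edges unfolding P_def tseitin_vars_def flow_empty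
    by (elim provable_mono) (simp add: mult_le_mono1)
  have "0 \<notin> residues p C (n + card edges) (int n)"
  proof
    assume "0 \<in> residues p C (n + card edges) (int n)"
    then have "[0 = n] (mod p)"
      by (simp add: residues_def flip: cong_int_iff)
    with n(2) have "[0 = 1] (mod p)" by (rule cong_trans[rotated])
    then show False using p by (simp add: cong_def)
  qed
  moreover have "residues p C (n + card edges) (int n) \<subseteq> {-int B..int B}"
    unfolding B using card_edges by (intro residues_subset) simp
  moreover have "3 * (2 * B + 1) * B \<le> s" by (simp add: s algebra_simps)
  ultimately have "provable p (N + 3) s (tseitin_vars G p) (neg_tseitin G p)
      (?J * M + ?J * M + (2 * B + 2)) {}"
    using zero by (intro provable_simplify[where B = B]) auto
  then show ?thesis by (rule provable_refutation)
qed

theorem theorem6p9: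
  fixes p r :: nat
  assumes "p \<ge> 2"
  shows "\<exists>(c :: nat) (k :: nat) (q :: nat poly).
    \<forall>(G :: ('a, 'b) pre_digraph) (n :: nat).
      graph G \<and> Digraph_Component.connected G \<and> regular G r \<and>
      card (verts G) = n \<and> [n = 1] (mod p) \<longrightarrow>
      (\<exists>\<pi>. R0lin_refutation c k (tseitin_vars G p) (neg_tseitin G p) \<pi> \<and>
           proof_size \<pi> \<le> poly q n)"
proof -
  \<comment> \<open>\<open>C\<close> and \<open>N\<close> depend on \<open>p\<close> and
    \<open>r\<close> only. The polynomials below repeat the expressions of
    \<open>tseitin_refutation\<close> with \<open>X\<close> in place of \<open>n\<close>, so that
    evaluating \<open>q\<close> at \<open>n\<close> gives its bound.\<close>
  define C where "C = (r + 2) * p"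
  define N where "N = (p + 1) ^ ((r + 2) * p) * (2 * C + 1)"
  define X :: "nat poly" where "X = [:0, 1:]"
  define J where "J = X + X * [:r:]"
  define B where "B = [:C:] * J"
  define s where "s = [:N:] * [:(r + 2) * p * p + C:] +
    [:3:] * ([:2:] * B + [:1:]) * (X * [:r:] * [:p:] * [:p:] + B)"
  define M where "M = [:2 ^ N:] + ([:2:] * B + [:2:]) ^ 3"
  define q where "q = (J * M + J * M + ([:2:] * B + [:2:])) * s"
  have "\<exists>\<pi>. R0lin_refutation p (N + 3) (tseitin_vars G p) (neg_tseitin G p) \<pi> \<and> proof_size \<pi> \<le> poly q n"
    if "graph G" "regular G r" "card (verts G) = n" "[n = 1] (mod p)"
    for G :: "('a, 'b) pre_digraph" and n
  proof -
    have J: "poly J n = n + n * r" by (simp add: J_def X_def)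
    have B: "poly B n = C * (n + n * r)" by (simp add: B_def J)
    have s: "poly s n = N * ((r + 2) * p * p + C) +
        3 * (2 * poly B n + 1) * (n * r * p * p + poly B n)"
      by (simp add: s_def X_def algebra_simps)
    have M: "poly M n = 2 ^ N + (2 * poly B n + 2) ^ 3" by (simp add: M_def)
    have "poly q n = ((n + n * r) * poly M n + (n + n * r) * poly M n + (2 * poly B n + 2)) * poly s n"
      by (simp add: q_def J)
    then show ?thesis
      using graph.tseitin_refutation[OF that(1) assms that(2-4) C_def N_def B s M] by simp
  qed
  then show ?thesis by blast
qed

end
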